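(* Given a Fixed-Permutation State-Space Model (FPSSM) over $x=(x_1,\dots,x_n)$ of state-size $k$, there exists a Fixed-Permutation Linear Model (FPLM) of dimension $k$ which computes the same function of $x$.
   Context: Let $x=(x_1,\dots,x_n)$ with $x_i\in R_i\subseteq\mathbb{R}$, and write $[k]=\{1,\dots,k\}$. FPSSM: given by a fixed permutation $\pi$ of $[n]$, a state-size $k$, an initial state $c\in[k]$, a decoding function $h:[k]\to\mathbb{R}_{\ge0}$, and for each $i\in[n]$ an arbitrary function $g_i:R_i\times[k]\to[k]$. Its output is $h\big(g_{\pi(n)}(x_{\pi(n)},g_{\pi(n-1)}(x_{\pi(n-1)},\cdots g_{\pi(1)}(x_{\pi(1)},c)\cdots))\big)$. FPLM: given by a fixed permutation $\pi$ of $[n]$, a dimension $k$, vectors $a,b\in\mathbb{R}_{\ge0}^k$, and for each $i\in[n]$ a function $T_i:R_i\to\mathbb{R}_{\ge0}^{k\times k}$. Its output is $b^\top T_{\pi(n)}(x_{\pi(n)})T_{\pi(n-1)}(x_{\pi(n-1)})\cdots T_{\pi(1)}(x_{\pi(1)})a$. *)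

theory Defs
  imports "HOL-Combinatorics.Permutations" "HOL-Library.FuncSet" "Jordan_Normal_Form.Matrix"
begin

text \<open>
  An input is a function \<open>x :: nat \<Rightarrow> real\<close>, of which only the coordinates
  \<open>x 1, \<dots>, x n\<close> matter; coordinate \<open>i\<close> ranges over \<open>R i\<close>. The component functions of both
  models are total in HOL, but are constrained only on \<open>R i\<close>, respectively on the state set
  \<open>{1..k}\<close>.
\<close>

record fpssm =
  ssm_perm :: "nat \<Rightarrow> nat"
  ssm_init :: nat
  ssm_dec :: "nat \<Rightarrow> real"
  ssm_step :: "nat \<Rightarrow> real \<Rightarrow> nat \<Rightarrow> nat"

definition is_fpssm :: "nat \<Rightarrow> (nat \<Rightarrow> real set) \<Rightarrow> nat \<Rightarrow> fpssm \<Rightarrow> bool" where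
  "is_fpssm n R k M \<longleftrightarrow>
     ssm_perm M permutes {1..n} \<and>
     ssm_init M \<in> {1..k} \<and>
     (\<forall>s\<in>{1..k}. 0 \<le> ssm_dec M s) \<and>
     (\<forall>i\<in>{1..n}. \<forall>r\<in>R i. \<forall>s\<in>{1..k}. ssm_step M i r s \<in> {1..k})"

primrec fpssm_state :: "fpssm \<Rightarrow> (nat \<Rightarrow> real) \<Rightarrow> nat \<Rightarrow> nat" where
  "fpssm_state M x 0 = ssm_init M"
| "fpssm_state M x (Suc j) =
     ssm_step M (ssm_perm M (Suc j)) (x (ssm_perm M (Suc j))) (fpssm_state M x j)"

definition fpssm_output :: "nat \<Rightarrow> fpssm \<Rightarrow> (nat \<Rightarrow> real) \<Rightarrow> real" where
  "fpssm_output n M x = ssm_dec M (fpssm_state M x n)"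

record fplm =
  lm_perm :: "nat \<Rightarrow> nat"
  lm_init :: "real vec"
  lm_final :: "real vec"
  lm_mat :: "nat \<Rightarrow> real \<Rightarrow> real mat"

definition nonneg_vec :: "real vec \<Rightarrow> bool" where
  "nonneg_vec v \<longleftrightarrow> (\<forall>p<dim_vec v. 0 \<le> v $ p)"

definition nonneg_mat :: "real mat \<Rightarrow> bool" where
  "nonneg_mat A \<longleftrightarrow> (\<forall>p<dim_row A. \<forall>q<dim_col A. 0 \<le> A $$ (p, q))"

definition is_fplm :: "nat \<Rightarrow> (nat \<Rightarrow> real set) \<Rightarrow> nat \<Rightarrow> fplm \<Rightarrow> bool" where
  "is_fplm n R k L \<longleftrightarrow>
     lm_perm L permutes {1..n} \<and>
     lm_init L \<in> carrier_vec k \<and> nonneg_vec (lm_init L) \<and>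
     lm_final L \<in> carrier_vec k \<and> nonneg_vec (lm_final L) \<and>
     (\<forall>i\<in>{1..n}. \<forall>r\<in>R i. lm_mat L i r \<in> carrier_mat k k \<and> nonneg_mat (lm_mat L i r))"

text \<open>The product of the first \<open>j\<close> matrices read, the most recently read one leftmost.\<close>

primrec fplm_prod :: "nat \<Rightarrow> fplm \<Rightarrow> (nat \<Rightarrow> real) \<Rightarrow> nat \<Rightarrow> real mat" where
  "fplm_prod k L x 0 = 1\<^sub>m k"
| "fplm_prod k L x (Suc j) =
     lm_mat L (lm_perm L (Suc j)) (x (lm_perm L (Suc j))) * fplm_prod k L x j"

definition fplm_output :: "nat \<Rightarrow> nat \<Rightarrow> fplm \<Rightarrow> (nat \<Rightarrow> real) \<Rightarrow> real" where
  "fplm_output n k L x = lm_final L \<bullet> (fplm_prod k L x n *\<^sub>v lm_init L)"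

end

theory Submission
  imports Defs
begin

text \<open>
  Encode the state \<open>s\<close> as the basis vector \<open>e\<^sub>s\<close>. Every map on states extends to a linear map whose
  matrix has 0/1 entries, so the vector carried by the linear model always encodes the current
  state, and the decoding function is read off by the inner product with its vector of values.
\<close>

definition state_vec :: "nat \<Rightarrow> nat \<Rightarrow> real vec" where
  \<comment> \<open>States are numbered from 1, vector entries from 0.\<close>
  "state_vec k s = unit_vec k (s - 1)"

text \<open>Column \<open>q\<close> encodes the image of state \<open>Suc q\<close>; it is zero if
  that image falls outside \<open>{1..k}\<close>.\<close>

definition transition_mat :: "nat \<Rightarrow> (nat \<Rightarrow> nat) \<Rightarrow> real mat" where
  "transition_mat k f = mat k k (\<lambda>(p, q). if f (Suc q) = Suc p then 1 else 0)"

definition dec_vec :: "nat \<Rightarrow> (nat \<Rightarrow> real) \<Rightarrow> real vec" where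
  "dec_vec k h = vec k (\<lambda>p. h (Suc p))"

definition fplm_of_fpssm :: "nat \<Rightarrow> fpssm \<Rightarrow> fplm" where
  "fplm_of_fpssm k M =
     \<lparr>lm_perm = ssm_perm M, lm_init = state_vec k (ssm_init M), lm_final = dec_vec k (ssm_dec M),
      lm_mat = \<lambda>i r. transition_mat k (ssm_step M i r)\<rparr>"

lemma state_vec_carrier [simp]: "state_vec k s \<in> carrier_vec k"
  by (simp add: state_vec_def)

lemma transition_mat_carrier [simp]: "transition_mat k f \<in> carrier_mat k k"
  by (simp add: transition_mat_def)

text \<open>A basis vector selects a column, here column \<open>s - 1\<close>, whose single 1 stands
  in row \<open>f s - 1\<close>. The bounds exclude state 0, which truncated subtraction would
  encode like state 1.\<close>

lemma transition_mat_mult_state_vec: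
  assumes "s \<in> {1..k}" "f s \<in> {1..k}"
  shows "transition_mat k f *\<^sub>v state_vec k s = state_vec k (f s)"
proof (rule eq_vecI)
  fix p assume "p < dim_vec (state_vec k (f s))"
  then have p: "p < k"
    by (simp add: state_vec_def)
  have s: "s - Suc 0 < k"
    using assms by auto
  have "(transition_mat k f *\<^sub>v state_vec k s) $ p = transition_mat k f $$ (p, s - 1)"
    using s p by (simp add: transition_mat_def state_vec_def)
  also have "\<dots> = state_vec k (f s) $ p"
    using assms s p by (auto simp: transition_mat_def state_vec_def unit_vec_def)
  finally show "(transition_mat k f *\<^sub>v state_vec k s) $ p = state_vec k (f s) $ p" .
qed (simp add: transition_mat_def state_vec_def)

lemma dec_vec_scalar_prod_state_vec:
  assumes "s \<in> {1..k}"
  shows "dec_vec k h \<bullet> state_vec k s = h s"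
  using assms by (auto simp: dec_vec_def state_vec_def)

lemma is_fplm_fplm_of_fpssm:
  assumes "is_fpssm n R k M"
  shows "is_fplm n R k (fplm_of_fpssm k M)"
  using assms
  by (auto simp: is_fpssm_def is_fplm_def fplm_of_fpssm_def nonneg_vec_def nonneg_mat_def
      state_vec_def unit_vec_def dec_vec_def transition_mat_def)

text \<open>Supplies the dimensions that associativity requires in the induction on the
  product.\<close>

lemma fplm_prod_carrier:
  "fplm_prod k (fplm_of_fpssm k M) x j \<in> carrier_mat k k"
  by (induction j) (auto simp: fplm_of_fpssm_def intro!: mult_carrier_mat)

text \<open>The permutation keeps the index read at time \<open>j\<close> inside
  \<open>{1..n}\<close>, so the closure condition, given per coordinate, transfers to time
  steps.\<close>

lemma fpssm_step_closed:
  assumes "is_fpssm n R k M" "x \<in> Pi {1..n} R" "j \<in> {1..n}" "s \<in> {1..k}"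
  shows "ssm_step M (ssm_perm M j) (x (ssm_perm M j)) s \<in> {1..k}"
proof -
  have "ssm_perm M j \<in> {1..n}"
    using assms(1,3) unfolding is_fpssm_def by (metis permutes_in_image)
  with assms show ?thesis
    unfolding is_fpssm_def by blast
qed

lemma fpssm_state_closed:
  assumes "is_fpssm n R k M" "x \<in> Pi {1..n} R" "j \<le> n"
  shows "fpssm_state M x j \<in> {1..k}"
  using assms(3)
proof (induction j)
  case 0
  then show ?case
    using assms(1) by (simp add: is_fpssm_def)
next
  case (Suc j)
  then show ?case
    using fpssm_step_closed[OF assms(1,2), of "Suc j"] by simp
qed

text \<open>The invariant, by induction on \<open>j\<close>; the bound \<open>j \<le> n\<close> is
  what keeps the states inside \<open>{1..k}\<close>, where the encoding is faithful.\<close>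

lemma fplm_prod_mult_init:
  assumes "is_fpssm n R k M" "x \<in> Pi {1..n} R" "j \<le> n"
  shows "fplm_prod k (fplm_of_fpssm k M) x j *\<^sub>v state_vec k (ssm_init M) =
    state_vec k (fpssm_state M x j)"
  using assms(3)
proof (induction j)
  case 0
  then show ?case
    by simp
next
  case (Suc j)
  let ?f = "ssm_step M (ssm_perm M (Suc j)) (x (ssm_perm M (Suc j)))"
  \<comment> \<open>The newest matrix is the leftmost factor, so associativity lets it act last, on
    the vector of the induction hypothesis.\<close>
  have "fplm_prod k (fplm_of_fpssm k M) x (Suc j) *\<^sub>v state_vec k (ssm_init M) =
      transition_mat k ?f *\<^sub>v
        (fplm_prod k (fplm_of_fpssm k M) x j *\<^sub>v state_vec k (ssm_init M))"
    by (simp add: fplm_of_fpssm_def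
        assoc_mult_mat_vec[OF transition_mat_carrier fplm_prod_carrier[unfolded fplm_of_fpssm_def]])
  also have "\<dots> = transition_mat k ?f *\<^sub>v state_vec k (fpssm_state M x j)"
    using Suc by simp
  also have "\<dots> = state_vec k (?f (fpssm_state M x j))"
    using Suc.prems fpssm_state_closed[OF assms(1,2), of j]
      fpssm_step_closed[OF assms(1,2), of "Suc j"]
    by (intro transition_mat_mult_state_vec) auto
  finally show ?case
    by simp
qed

theorem proposition22:
  fixes n k :: nat and R :: "nat \<Rightarrow> real set" and M :: fpssm
  assumes "is_fpssm n R k M"
  shows "\<exists>L. is_fplm n R k L \<and>
    (\<forall>x \<in> Pi {1..n} R. fplm_output n k L x = fpssm_output n M x)"
proof (intro exI conjI ballI)
  show "is_fplm n R k (fplm_of_fpssm k M)"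
    by (rule is_fplm_fplm_of_fpssm[OF assms])
  fix x assume x: "x \<in> Pi {1..n} R"
  have "fplm_output n k (fplm_of_fpssm k M) x =
      dec_vec k (ssm_dec M) \<bullet>
        (fplm_prod k (fplm_of_fpssm k M) x n *\<^sub>v state_vec k (ssm_init M))"
    unfolding fplm_output_def by (simp add: fplm_of_fpssm_def)
  \<comment> \<open>The invariant at \<open>j = n\<close> leaves the encoding of the final state,
    and the inner product picks out its decoded value.\<close>
  also have "\<dots> = fpssm_output n M x"
    using fpssm_state_closed[OF assms x order_refl]
    by (simp add: fplm_prod_mult_init[OF assms x] dec_vec_scalar_prod_state_vec fpssm_output_def)
  finally show "fplm_output n k (fplm_of_fpssm k M) x = fpssm_output n M x" .
qed

end
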